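(* Let $1<p_1,p_2\leq\infty$, $\frac{1}{p_1}+\frac{1}{p_2}=\frac{1}{p}$ and $0<\theta<2\pi$. If $p_1\leq2$ or $p_2\leq2$, then the operator $\mathcal{M}^\theta$ does not map $L^{p_1,1}(\mathbb{R}^2)\times L^{p_2,1}(\mathbb{R}^2)$ boundedly to $L^{p,\infty}(\mathbb{R}^2)$, i.e. there is no constant $C$ such that $\|\mathcal{M}^\theta(f,g)\|_{L^{p,\infty}}\le C\|f\|_{L^{p_1,1}}\|g\|_{L^{p_2,1}}$ for all $f\in L^{p_1,1}(\mathbb{R}^2)$, $g\in L^{p_2,1}(\mathbb{R}^2)$. In particular, $\mathcal{M}^\theta$ is not bounded from $L^{2,1}(\mathbb{R}^2)\times L^{2,1}(\mathbb{R}^2)$ to $L^{1,\infty}(\mathbb{R}^2)$.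
   Context: For $0<\theta<2\pi$ and $t>0$, $$\mathcal{A}_t^\theta(f,g)(x)=\int_{\mathbb{S}^{1}}f(x-ty)\,g(x-t\Theta y)\,d\sigma(y),\qquad x\in\mathbb{R}^2,$$ where $\sigma$ is the arc length measure on the unit circle $\mathbb{S}^1\subset\mathbb{R}^2$ and $\Theta$ is the counter-clockwise rotation of $\mathbb{R}^2$ by the angle $\theta$; and $\mathcal{M}^\theta(f,g)(x)=\sup_{t>0}|\mathcal{A}_t^\theta(f,g)(x)|$. $L^{p,s}$ denotes the Lorentz space; $L^{\infty,1}$ is interpreted as $L^\infty$. *)

theory Defs
  imports "HOL-Analysis.Analysis" "HOL-Probability.Essential_Supremum"
begin

section \<open>Lorentz spaces\<close>

text \<open>Only used for exponents \<open>r > 0\<close>.\<close>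

definition enn_powr :: "ennreal \<Rightarrow> real \<Rightarrow> ennreal" where
  "enn_powr x r = (if x = \<infinity> then \<infinity> else ennreal (enn2real x powr r))"

text \<open>
  The notions below are stated for \<open>[0, \<infinity>]\<close>-valued functions \<open>h\<close>: they are applied to the modulus
  of a complex function, and to maximal functions, which may take the value \<open>\<infinity>\<close>.
\<close>

definition distribution_fun :: "'a measure \<Rightarrow> ('a \<Rightarrow> ennreal) \<Rightarrow> ennreal \<Rightarrow> ennreal" where
  "distribution_fun M h \<alpha> = emeasure M {x \<in> space M. h x > \<alpha>}"

definition decreasing_rearrangement :: "'a measure \<Rightarrow> ('a \<Rightarrow> ennreal) \<Rightarrow> real \<Rightarrow> ennreal" where
  "decreasing_rearrangement M h t = Inf {\<alpha>. distribution_fun M h \<alpha> \<le> ennreal t}"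

text \<open>
  The exponents range over \<open>(0, \<infinity>]\<close>; in \<^typ>\<open>ennreal\<close> one has \<open>1 / \<infinity> = 0\<close>. For \<open>p = \<infinity>\<close> the space
  is \<open>L\<^sup>\<infinity>\<close> whatever the second exponent is; in particular this is the convention \<open>L\<^sup>\<infinity>\<^sup>,\<^sup>1 = L\<^sup>\<infinity>\<close>.
  For \<open>p < \<infinity>\<close> it is the usual quasi-norm: the \<open>L\<^sup>s(dt/t)\<close> norm of \<open>t powr (1/p) * h\<^sup>*(t)\<close> on
  \<open>(0, \<infinity>)\<close>.
\<close>

definition lorentz_norm :: "'a measure \<Rightarrow> ennreal \<Rightarrow> ennreal \<Rightarrow> ('a \<Rightarrow> ennreal) \<Rightarrow> ennreal" where
  "lorentz_norm M p s h =
    (if p = \<infinity> then esssup M h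
     else if s = \<infinity> then
       (SUP t\<in>{0<..}. ennreal (t powr (1 / enn2real p)) * decreasing_rearrangement M h t)
     else
       enn_powr
         (\<integral>\<^sup>+t\<in>{0<..}.
            enn_powr (ennreal (t powr (1 / enn2real p)) * decreasing_rearrangement M h t) (enn2real s)
              * ennreal (1 / t) \<partial>lborel)
         (1 / enn2real s))"

definition lorentz_space :: "'a measure \<Rightarrow> ennreal \<Rightarrow> ennreal \<Rightarrow> ('a \<Rightarrow> complex) set" where
  "lorentz_space M p s =
    {f \<in> borel_measurable M. lorentz_norm M p s (\<lambda>x. ennreal (norm (f x))) < \<infinity>}"

section \<open>The bilinear circular maximal function\<close>

text \<open>
  Arc length on the unit circle as a measure on the plane. The completion makes the integral
  meaningful for integrands that are only arc-length (not Borel) measurable.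
\<close>

definition arc_length :: "(real^2) measure" where
  "arc_length =
    completion (distr (restrict_space lborel {0..<2 * pi}) borel (\<lambda>\<phi>. vector [cos \<phi>, sin \<phi>]))"

definition rotation :: "real \<Rightarrow> real^2 \<Rightarrow> real^2" where
  "rotation \<theta> y = vector [cos \<theta> * y $ 1 - sin \<theta> * y $ 2, sin \<theta> * y $ 1 + cos \<theta> * y $ 2]"

text \<open>
  The Bochner integral is \<open>0\<close> when the integrand is not integrable. With this convention the maximal
  function is as small as possible, so that unboundedness never comes from undefined averages.
\<close>

definition circular_average ::
  "real \<Rightarrow> real \<Rightarrow> (real^2 \<Rightarrow> complex) \<Rightarrow> (real^2 \<Rightarrow> complex) \<Rightarrow> real^2 \<Rightarrow> complex" where
  "circular_average \<theta> t f g x =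
    (\<integral>y. f (x - t *\<^sub>R y) * g (x - t *\<^sub>R rotation \<theta> y) \<partial>arc_length)"

definition circular_maximal ::
  "real \<Rightarrow> (real^2 \<Rightarrow> complex) \<Rightarrow> (real^2 \<Rightarrow> complex) \<Rightarrow> real^2 \<Rightarrow> ennreal" where
  "circular_maximal \<theta> f g x = (SUP t\<in>{0<..}. ennreal (norm (circular_average \<theta> t f g x)))"

text \<open>
  \<open>lebesgue\<close> rather than \<open>lborel\<close>: superlevel sets of a supremum over uncountably many \<open>t\<close> need not
  be Borel, and \<^const>\<open>emeasure\<close> is \<open>0\<close> outside the \<open>\<sigma>\<close>-algebra.
\<close>

definition lorentz_bounded ::
  "((real^2 \<Rightarrow> complex) \<Rightarrow> (real^2 \<Rightarrow> complex) \<Rightarrow> real^2 \<Rightarrow> ennreal) \<Rightarrow>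
    ennreal \<times> ennreal \<Rightarrow> ennreal \<times> ennreal \<Rightarrow> ennreal \<times> ennreal \<Rightarrow> bool" where
  "lorentz_bounded T = (\<lambda>(p1, s1) (p2, s2) (p, s).
    \<exists>C::real. \<forall>f \<in> lorentz_space lebesgue p1 s1. \<forall>g \<in> lorentz_space lebesgue p2 s2.
      lorentz_norm lebesgue p s (T f g) \<le>
        ennreal C * lorentz_norm lebesgue p1 s1 (\<lambda>x. ennreal (norm (f x)))
                  * lorentz_norm lebesgue p2 s2 (\<lambda>x. ennreal (norm (g x))))"

end

theory Submission
  imports Defs
begin

text \<open>
  Fix a set \<open>B\<close> of small area containing, together with a neighbourhood of width \<open>\<rho>\<close>, a segment over
  \<open>[0, 1]\<close> of every slope in \<open>[0, 1)\<close>, and let \<open>f\<close> be a continuous version of the indicator of \<open>\<rho> B\<close>.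
  A point \<open>x\<close> at distance about \<open>1\<close> from the origin is the centre of a circle tangent to the segment in
  \<open>\<rho> B\<close> that is orthogonal to \<open>x\<close>; since a circle deviates by \<open>O(\<rho>\<^sup>2)\<close> from its tangent along
  an arc of length comparable to \<open>\<rho>\<close>, such an arc lies in \<open>\<rho> B\<close>. Taking for \<open>g\<close> a bump function that is
  \<open>1\<close> on a large ball, the maximal function is therefore at least \<open>\<rho> / 4\<close> on a fixed set of area \<open>1\<close>, whereas
  the \<open>L\<^bsup>p1,1\<^esup>\<close> norm of \<open>f\<close> is of order at most \<open>\<rho> |B|\<^bsup>1/2\<^esup>\<close> for \<open>p1 \<le> 2\<close>. Hence no constant works once \<open>|B|\<close> is small. The
  case \<open>p2 \<le> 2\<close> follows by exchanging \<open>f\<close> and \<open>g\<close>, which replaces \<open>\<theta>\<close> by \<open>2\<pi> - \<theta>\<close>.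
\<close>

section \<open>Lorentz norms\<close>

lemma enn_powr_1 [simp]: "enn_powr x 1 = x"
  by (cases x) (auto simp: enn_powr_def)

text \<open>The decreasing rearrangement is at most 1 and vanishes from \<open>m\<close> on, so the
  norm is at most the integral of \<open>t powr (1/p - 1)\<close> over
  \<open>[0, m]\<close>.\<close>

lemma lorentz_norm_1_le:
  fixes M :: "'a measure"
  assumes p: "0 < p" "p < \<infinity>" and m: "0 \<le> m"
    and supp: "emeasure M {x \<in> space M. h x > 0} \<le> ennreal m" and le1: "\<And>x. h x \<le> 1"
  shows "lorentz_norm M p 1 h \<le> ennreal (enn2real p * m powr (1 / enn2real p))"
proof -
  define q where "q = enn2real p"
  have q: "q > 0" using p by (simp add: q_def enn2real_positive_iff top.not_eq_extremum less_top)
  have 0: "decreasing_rearrangement M h t = 0" if "t \<ge> m" for t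
  proof -
    have "distribution_fun M h 0 \<le> ennreal t"
      using supp that unfolding distribution_fun_def by (meson ennreal_leI order_trans)
    then have "decreasing_rearrangement M h t \<le> 0"
      unfolding decreasing_rearrangement_def by (intro Inf_lower) auto
    then show ?thesis by simp
  qed
  have 1: "decreasing_rearrangement M h t \<le> 1" for t
    unfolding decreasing_rearrangement_def
  proof (intro Inf_lower)
    have "{x \<in> space M. h x > 1} = {}" using le1 by (auto simp: not_less)
    then show "1 \<in> {\<alpha>. distribution_fun M h \<alpha> \<le> ennreal t}"
      by (simp add: distribution_fun_def del: Collect_empty_eq)
  qed
  have "lorentz_norm M p 1 h = (\<integral>\<^sup>+t\<in>{0<..}. ennreal (t powr (1 / q)) * decreasing_rearrangement M h t
              * ennreal (1 / t) \<partial>lborel)"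
    using less_imp_neq[OF p(2)] by (simp add: lorentz_norm_def q_def)
  also have "\<dots> \<le> (\<integral>\<^sup>+t\<in>{0..m}. ennreal (t powr (1 / q - 1)) \<partial>lborel)"
  proof (rule nn_integral_mono)
    fix t :: real
    show "ennreal (t powr (1 / q)) * decreasing_rearrangement M h t * ennreal (1 / t) * indicator {0<..} t
      \<le> ennreal (t powr (1 / q - 1)) * indicator {0..m} t"
    proof (cases "0 < t \<and> t < m")
      case True
      have "ennreal (t powr (1 / q)) * decreasing_rearrangement M h t * ennreal (1 / t)
          \<le> ennreal (t powr (1 / q)) * 1 * ennreal (1 / t)"
        by (intro mult_mono 1) auto
      also have "\<dots> = ennreal (t powr (1 / q - 1))"
        using True by (simp add: powr_diff flip: ennreal_mult)
      finally show ?thesis using True by simp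
    next
      case False
      then show ?thesis using 0 by (cases "t > 0") (auto simp: not_less)
    qed
  qed
  also have "\<dots> = ennreal (m powr (1 / q - 1 + 1) / (1 / q - 1 + 1))"
    using q m has_integral_powr_from_0[of "1 / q - 1" m]
    by (intro nn_integral_has_integral_lebesgue') auto
  also have "\<dots> = ennreal (q * m powr (1 / q))" using q by (simp add: field_simps)
  finally show ?thesis by (simp add: q_def)
qed

text \<open>A single \<open>t\<close> of the supremum suffices: any level below \<mu> has a
  superlevel set containing \<open>A\<close>, hence of measure greater than \<open>t\<close>. The
  strict inequality matters, since the rearrangement of an indicator is already 0 at the measure of
  its set.\<close>

lemma lorentz_norm_weak_ge:
  fixes M :: "'a measure"
  assumes p: "p < \<infinity>" and t: "0 < t"
    and meas: "\<And>\<alpha>. {x \<in> space M. h x > \<alpha>} \<in> sets M"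
    and A: "A \<subseteq> space M" "\<And>x. x \<in> A \<Longrightarrow> \<mu> \<le> h x" "ennreal t < emeasure M A"
  shows "ennreal (t powr (1 / enn2real p)) * \<mu> \<le> lorentz_norm M p \<infinity> h"
proof -
  have "\<mu> \<le> decreasing_rearrangement M h t"
    unfolding decreasing_rearrangement_def
  proof (intro Inf_greatest)
    fix \<alpha> assume "\<alpha> \<in> {\<alpha>. distribution_fun M h \<alpha> \<le> ennreal t}"
    then have le: "emeasure M {x \<in> space M. h x > \<alpha>} \<le> ennreal t"
      by (simp add: distribution_fun_def)
    show "\<mu> \<le> \<alpha>"
    proof (rule ccontr)
      assume "\<not> \<mu> \<le> \<alpha>"
      then have "A \<subseteq> {x \<in> space M. h x > \<alpha>}" using A(1,2) by (auto simp: not_le intro: less_le_trans)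
      then have "emeasure M A \<le> emeasure M {x \<in> space M. h x > \<alpha>}" by (intro emeasure_mono meas)
      with le A(3) show False by (meson leD order_trans)
    qed
  qed
  then have "ennreal (t powr (1 / enn2real p)) * \<mu>
      \<le> ennreal (t powr (1 / enn2real p)) * decreasing_rearrangement M h t"
    by (intro mult_left_mono) auto
  also have "\<dots> \<le> lorentz_norm M p \<infinity> h"
    using p t by (auto simp: lorentz_norm_def intro!: SUP_upper2[where i=t])
  finally show ?thesis .
qed

text \<open>This puts the test functions into their Lorentz spaces. The exponent \<infinity> is
  included because only one of the two exponents is assumed to be at most 2.\<close>

lemma lorentz_norm_bump_finite:
  fixes f :: "real^2 \<Rightarrow> real"
  assumes "continuous_on UNIV f" "\<And>x. 0 \<le> f x" "\<And>x. f x \<le> 1"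
    "emeasure lebesgue {x. f x \<noteq> 0} < \<infinity>" "0 < p"
  shows "lorentz_norm lebesgue p 1 (\<lambda>x. ennreal (f x)) < \<infinity>"
proof (cases "p = \<infinity>")
  case True
  have "f \<in> borel_measurable borel" using assms(1) by (rule borel_measurable_continuous_onI)
  then have "(\<lambda>x. ennreal (f x)) \<in> borel_measurable lebesgue"
    by (intro measurable_completion) simp
  then have "esssup lebesgue (\<lambda>x. ennreal (f x)) \<le> 1"
    using assms(3) by (intro esssup_I) auto
  then show ?thesis using True by (simp add: lorentz_norm_def order_le_less_trans)
next
  case False
  have "{x. ennreal (f x) > 0} = {x. f x \<noteq> 0}" using assms(2) by (auto simp: less_le)
  moreover obtain m where "0 \<le> m" "emeasure lebesgue {x. f x \<noteq> 0} = ennreal m"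
    using assms(4) by (cases "emeasure lebesgue {x. f x \<noteq> 0}") auto
  ultimately have "lorentz_norm lebesgue p 1 (\<lambda>x. ennreal (f x)) \<le> ennreal (enn2real p * m powr (1 / enn2real p))"
    using assms False by (intro lorentz_norm_1_le) (auto simp: less_top)
  then show ?thesis by (simp add: order_le_less_trans)
qed

section \<open>Circular averages of continuous functions\<close>

definition circle_point :: "real \<Rightarrow> real^2" where
  "circle_point \<phi> = vector [cos \<phi>, sin \<phi>]"

lemma circle_point_nth [simp]: "circle_point \<phi> $ 1 = cos \<phi>" "circle_point \<phi> $ 2 = sin \<phi>"
  by (simp_all add: circle_point_def)

lemma rotation_circle_point: "rotation \<theta> (circle_point \<phi>) = circle_point (\<phi> + \<theta>)"
  by (simp add: rotation_def circle_point_def cos_add sin_add algebra_simps)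

lemma circle_point_periodic: "circle_point (\<phi> + 2 * pi) = circle_point \<phi>"
  by (simp add: circle_point_def)

lemma norm_circle_point: "norm (circle_point \<phi>) = 1"
  by (simp add: norm_vec_def L2_set_def UNIV_2)

lemma continuous_on_vec2: 
  fixes f :: "'a::t2_space \<Rightarrow> real^2"
  assumes "continuous_on S (\<lambda>x. f x $ 1)" "continuous_on S (\<lambda>x. f x $ 2)"
  shows "continuous_on S f"
proof -
  have "continuous_on S (\<lambda>x. \<chi> i. f x $ i)"
    using assms by (intro continuous_on_vec_lambda) (metis exhaust_2)
  then show ?thesis by simp
qed

lemma continuous_on_circle_point [continuous_intros]:
  fixes f :: "'a::t2_space \<Rightarrow> real"
  shows "continuous_on S f \<Longrightarrow> continuous_on S (\<lambda>x. circle_point (f x))"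
  by (rule continuous_on_vec2) (simp_all add: continuous_on_cos continuous_on_sin)

lemma continuous_on_rotation: "continuous_on S (rotation \<theta>)"
  by (rule continuous_on_vec2) (auto simp: rotation_def intro!: continuous_intros)

text \<open>A continuous integrand is Borel, so the completion does not change its integral; along
  the circle it is continuous on a bounded interval, so the Bochner and gauge integrals
  agree.\<close>

lemma arc_length_integral:
  fixes h :: "real^2 \<Rightarrow> real"
  assumes "continuous_on UNIV h"
  shows "(\<integral>y. h y \<partial>arc_length) = integral {0..2*pi} (\<lambda>\<phi>. h (circle_point \<phi>))"
proof -
  have [measurable]: "h \<in> borel_measurable borel" using assms by (rule borel_measurable_continuous_onI)
  have "circle_point \<in> borel_measurable borel"
    by (intro borel_measurable_continuous_onI continuous_intros)
  then have m: "circle_point \<in> measurable (restrict_space lborel {0..<2*pi}) borel"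
    by (intro measurable_restrict_space1) simp
  have cont: "continuous_on UNIV (\<lambda>\<phi>. h (circle_point \<phi>))"
    by (rule continuous_on_compose2[OF assms]) (auto intro!: continuous_intros)
  have arc: "arc_length = completion (distr (restrict_space lborel {0..<2*pi}) borel circle_point)"
    by (simp add: arc_length_def circle_point_def [abs_def])
  have "(\<integral>y. h y \<partial>arc_length) = (\<integral>y. h y \<partial>distr (restrict_space lborel {0..<2*pi}) borel circle_point)"
    unfolding arc by (intro integral_completion) simp
  also have "\<dots> = (\<integral>\<phi>. h (circle_point \<phi>) \<partial>restrict_space lborel {0..<2*pi})"
    by (intro integral_distr m) simp
  also have "\<dots> = (LINT \<phi>:{0..<2*pi}|lborel. h (circle_point \<phi>))"
    by (subst integral_restrict_space) (auto simp: set_lebesgue_integral_def)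
  also have "\<dots> = integral {0..<2*pi} (\<lambda>\<phi>. h (circle_point \<phi>))"
  proof (rule set_borel_integral_eq_integral)
    have "set_integrable lborel {0..2*pi} (\<lambda>\<phi>. h (circle_point \<phi>))"
      by (intro borel_integrable_atLeastAtMost' continuous_on_subset[OF cont]) auto
    then show "set_integrable lborel {0..<2*pi} (\<lambda>\<phi>. h (circle_point \<phi>))"
      by (rule set_integrable_subset) auto
  qed
  also have "\<dots> = integral {0..2*pi} (\<lambda>\<phi>. h (circle_point \<phi>))"
    by (rule integral_subset_negligible)
      (auto intro: negligible_subset[of "{2*pi}"])
  finally show ?thesis .
qed

definition arc_average :: "real \<Rightarrow> real \<Rightarrow> (real^2 \<Rightarrow> real) \<Rightarrow> (real^2 \<Rightarrow> real) \<Rightarrow> real^2 \<Rightarrow> real" where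
  "arc_average \<theta> t f g x = integral {0..2*pi}
     (\<lambda>\<phi>. f (x - t *\<^sub>R circle_point \<phi>) * g (x - t *\<^sub>R circle_point (\<phi> + \<theta>)))"

lemma circular_average_of_real:
  assumes f: "continuous_on UNIV f" and g: "continuous_on UNIV g"
  shows "circular_average \<theta> t (\<lambda>z. of_real (f z)) (\<lambda>z. of_real (g z)) x = of_real (arc_average \<theta> t f g x)"
proof -
  have "continuous_on UNIV (\<lambda>y. f (x - t *\<^sub>R y) * g (x - t *\<^sub>R rotation \<theta> y))"
    by (intro continuous_intros continuous_on_compose2[OF f] continuous_on_compose2[OF g]
          continuous_on_rotation) auto
  then show ?thesis
    unfolding circular_average_def arc_average_def of_real_mult[symmetric] integral_complex_of_real
    by (simp add: arc_length_integral rotation_circle_point)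
qed

lemma continuous_on_arc_integrand:
  assumes f: "continuous_on UNIV f" and g: "continuous_on UNIV g"
  shows "continuous_on UNIV (\<lambda>(x, \<phi>). f (x - t *\<^sub>R circle_point \<phi>) * g (x - t *\<^sub>R circle_point (\<phi> + \<theta>)) :: real)"
  unfolding case_prod_beta
  by (intro continuous_intros continuous_on_compose2[OF f] continuous_on_compose2[OF g]) auto

lemma continuous_on_arc_average:
  assumes f: "continuous_on UNIV f" and g: "continuous_on UNIV g"
  shows "continuous_on UNIV (arc_average \<theta> t f g)"
  unfolding arc_average_def
  using integral_continuous_on_param[where U = UNIV and a = 0 and b = "2*pi",
      OF continuous_on_subset[OF continuous_on_arc_integrand[OF f g]]]
  by simp

text \<open>Cut \<open>[c, p + c]\<close> at \<open>p\<close> and move the right-hand piece back by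
  one period.\<close>

lemma integral_periodic_shift:
  fixes h :: "real \<Rightarrow> real"
  assumes cont: "continuous_on UNIV h" and per: "\<And>x. h (x + p) = h x" and c: "0 \<le> c" "c \<le> p"
  shows "integral {0..p} (\<lambda>x. h (x + c)) = integral {0..p} h"
proof -
  have int: "h integrable_on {a..b}" for a b
    by (intro integrable_continuous_real continuous_on_subset[OF cont]) auto
  have sh: "integral {a..b} (\<lambda>x. h (x + d)) = integral {a+d..b+d} h" for a b d
    using integral_shift_Icc_real[of a b h d] by (simp add: o_def add.commute)
  have "integral {0..p} (\<lambda>x. h (x + c)) = integral {c..p+c} h" by (simp add: sh)
  also have "\<dots> = integral {c..p} h + integral {p..p+c} h"
    using c by (subst Henstock_Kurzweil_Integration.integral_combine) (auto intro: int)
  also have "integral {p..p+c} h = integral {0..c} h"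
    using sh[of 0 c p] by (simp add: per add.commute)
  also have "integral {c..p} h + integral {0..c} h = integral {0..p} h"
    using c by (subst add.commute, subst Henstock_Kurzweil_Integration.integral_combine) (auto intro: int)
  finally show ?thesis .
qed

text \<open>Shifting the angle by \<theta> in the average on the right puts \<open>f\<close> at
  \<phi> + \<theta> and \<open>g\<close> at \<phi> + 2 pi, which is the same point as
  \<phi>.\<close>

lemma arc_average_swap:
  assumes f: "continuous_on UNIV f" and g: "continuous_on UNIV g" and \<theta>: "0 \<le> \<theta>" "\<theta> \<le> 2 * pi"
  shows "arc_average \<theta> t g f x = arc_average (2 * pi - \<theta>) t f g x"
proof -
  define h where "h \<phi> = f (x - t *\<^sub>R circle_point \<phi>) * g (x - t *\<^sub>R circle_point (\<phi> + (2*pi - \<theta>)))" for \<phi>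
  have "continuous_on UNIV h" unfolding h_def
    by (intro continuous_intros continuous_on_compose2[OF f] continuous_on_compose2[OF g]) auto
  moreover have "h (\<phi> + 2 * pi) = h \<phi>" for \<phi>
    using circle_point_periodic[of \<phi>] circle_point_periodic[of "\<phi> + (2*pi - \<theta>)"]
    by (simp add: h_def algebra_simps)
  ultimately have I: "integral {0..2*pi} (\<lambda>\<phi>. h (\<phi> + \<theta>)) = integral {0..2*pi} h"
    using \<theta> by (intro integral_periodic_shift)
  have "h (\<phi> + \<theta>) = g (x - t *\<^sub>R circle_point \<phi>) * f (x - t *\<^sub>R circle_point (\<phi> + \<theta>))" for \<phi>
  proof -
    have e: "\<phi> + \<theta> + (2 * pi - \<theta>) = \<phi> + 2 * pi" by simp
    show ?thesis unfolding h_def e circle_point_periodic by (rule mult.commute)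
  qed
  then show ?thesis using I by (simp only: arc_average_def h_def [abs_def])
qed

lemma circular_maximal_swap:
  assumes "continuous_on UNIV f" "continuous_on UNIV g" "0 \<le> \<theta>" "\<theta> \<le> 2 * pi"
  shows "circular_maximal \<theta> (\<lambda>z. of_real (g z)) (\<lambda>z. of_real (f z))
    = circular_maximal (2 * pi - \<theta>) (\<lambda>z. of_real (f z)) (\<lambda>z. of_real (g z))"
  unfolding circular_maximal_def circular_average_of_real[OF assms(2,1)] circular_average_of_real[OF assms(1,2)]
    arc_average_swap[OF assms] ..

text \<open>
  With \<open>f\<close> and \<open>g\<close> continuous, the superlevel sets are measurable, so that \<^const>\<open>emeasure\<close> does not
  take its default value \<open>0\<close> on them.
\<close>

lemma open_circular_maximal_superlevel:
  assumes f: "continuous_on UNIV f" and g: "continuous_on UNIV g"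
  shows "open {x. circular_maximal \<theta> (\<lambda>z. of_real (f z)) (\<lambda>z. of_real (g z)) x > \<alpha>}"
proof -
  have "{x. circular_maximal \<theta> (\<lambda>z. of_real (f z)) (\<lambda>z. of_real (g z)) x > \<alpha>}
      = (\<Union>t\<in>{0<..}. {x. ennreal \<bar>arc_average \<theta> t f g x\<bar> > \<alpha>})"
    by (auto simp: circular_maximal_def less_SUP_iff circular_average_of_real[OF f g])
  moreover have "open {x. ennreal \<bar>arc_average \<theta> t f g x\<bar> > \<alpha>}" for t
    using continuous_on_arc_average[OF f g]
    by (intro open_Collect_less continuous_intros continuous_on_ennreal)
  ultimately show ?thesis by auto
qed

text \<open>Since \<open>g\<close> is 1 on the whole circle, rotating its argument changes nothing
  and the bound is the same for every \<theta>.\<close>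

lemma arc_average_ge:
  assumes f: "continuous_on UNIV f" and g: "continuous_on UNIV g"
    and nonneg: "\<And>z. 0 \<le> f z" "\<And>z. 0 \<le> g z" and ab: "0 \<le> a" "a \<le> b" "b \<le> 2 * pi"
    and one: "\<And>\<phi>. \<lbrakk>a \<le> \<phi>; \<phi> \<le> b\<rbrakk> \<Longrightarrow> f (x - t *\<^sub>R circle_point \<phi>) = 1"
      "\<And>\<phi>. g (x - t *\<^sub>R circle_point \<phi>) = 1"
  shows "b - a \<le> arc_average \<theta> t f g x"
proof -
  let ?h = "\<lambda>\<phi>. f (x - t *\<^sub>R circle_point \<phi>) * g (x - t *\<^sub>R circle_point (\<phi> + \<theta>))"
  have c: "continuous_on UNIV ?h"
    by (intro continuous_intros continuous_on_compose2[OF f] continuous_on_compose2[OF g]) auto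
  have "b - a = integral {a..b} (\<lambda>_. 1)" using ab by simp
  also have "\<dots> = integral {a..b} ?h"
    by (rule integral_cong) (use one in auto)
  also have "\<dots> \<le> integral {0..2*pi} ?h"
    using ab nonneg
    by (intro integral_subset_le integrable_continuous_real continuous_on_subset[OF c]) auto
  finally show ?thesis by (simp add: arc_average_def)
qed

section \<open>Kakeya sets of small area\<close>

lemma emeasure_lebesgue_cbox_vec2:
  assumes "a1 \<le> b1" "a2 \<le> b2"
  shows "emeasure lebesgue (cbox (vector [a1, a2]) (vector [b1, b2] :: real^2)) = ennreal ((b1 - a1) * (b2 - a2))"
proof -
  have "cbox (vector [a1, a2]) (vector [b1, b2] :: real^2) \<noteq> {}"
    using assms by (auto simp: interval_ne_empty_cart forall_2)
  then have "measure lborel (cbox (vector [a1, a2]) (vector [b1, b2] :: real^2)) = (b1 - a1) * (b2 - a2)"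
    by (simp add: content_cbox_cart UNIV_2)
  then show ?thesis
    by (simp add: emeasure_eq_ennreal_measure less_imp_neq[OF emeasure_lborel_cbox_finite, simplified])
qed

text \<open>The strict inequality leaves room for an open set around \<open>K\<close> of measure at
  most \<open>m\<close>; a Urysohn function for \<open>K\<close> and the complement of that set does
  the rest.\<close>

lemma compact_bump:
  fixes K :: "'a::euclidean_space set"
  assumes K: "compact K" and lt: "emeasure lebesgue K < ennreal m"
  obtains F :: "'a \<Rightarrow> real" where "continuous_on UNIV F" "\<And>x. 0 \<le> F x" "\<And>x. F x \<le> 1"
    "\<And>x. x \<in> K \<Longrightarrow> F x = 1" "emeasure lebesgue {x. F x \<noteq> 0} \<le> ennreal m"
proof -
  have [measurable]: "K \<in> sets lebesgue" using K by (simp add: lmeasurable_compact fmeasurableD)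
  obtain c where c: "0 \<le> c" "emeasure lebesgue K = ennreal c"
    using lt by (cases "emeasure lebesgue K") auto
  with lt have "c < m" by (simp add: ennreal_less_iff)
  obtain T where T: "open T" "K \<subseteq> T" "T - K \<in> lmeasurable" "emeasure lebesgue (T - K) < ennreal (m - c)"
    using sets_lebesgue_outer_open[of K "m - c"] \<open>c < m\<close> by auto
  have "emeasure lebesgue T = emeasure lebesgue (K \<union> (T - K))"
    using T(2) by (intro arg_cong[where f = "emeasure lebesgue"]) auto
  also have "\<dots> \<le> emeasure lebesgue K + emeasure lebesgue (T - K)"
    using T(3) by (intro emeasure_subadditive) auto
  also have "\<dots> \<le> ennreal c + ennreal (m - c)"
    using T(4) c by (intro add_mono) auto
  also have "\<dots> = ennreal m" using c \<open>c < m\<close> by (simp flip: ennreal_plus)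
  finally have Tm: "emeasure lebesgue T \<le> ennreal m" .
  obtain F :: "'a \<Rightarrow> real" where F: "continuous_on UNIV F" "\<And>x. F x \<in> closed_segment 0 1"
    "\<And>x. x \<in> - T \<Longrightarrow> F x = 0" "\<And>x. x \<in> K \<Longrightarrow> F x = 1"
    by (rule Urysohn[of "- T" K 0 1]) (use T K in \<open>auto simp: compact_imp_closed\<close>)
  have "emeasure lebesgue {x. F x \<noteq> 0} \<le> emeasure lebesgue T"
    using F(3) T(1) by (intro emeasure_mono) auto
  with F Tm show ?thesis by (intro that[of F]) (auto simp: closed_segment_eq_real_ivl)
qed

text \<open>
  The intercept is chosen so that, with \<open>d\<^sub>j\<close> the base \<open>N\<close> digits of \<open>a \<in> [0, 1)\<close>, the line of slope
  \<open>a\<close> is \<open>\<Sum>\<^sub>j d\<^sub>j N\<^bsup>-j\<^esup> (s - (j - 1) / N)\<close>, up to the digits beyond the \<open>N\<close>-th (Abel summation turns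
  this into the formula below). Over \<open>k / N \<le> s \<le> (k + 1) / N\<close> the factor at \<open>j = k + 1\<close> is at most \<open>1 / N\<close>,
  so only the first \<open>k\<close> digits, that is \<open>q = \<lfloor>a N\<^bsup>k\<^esup>\<rfloor>\<close>, matter up to an error \<open>N\<^bsup>-k-1\<^esup>\<close>.
\<close>

definition kakeya_intercept :: "nat \<Rightarrow> real \<Rightarrow> real" where
  "kakeya_intercept N a = (\<Sum>j=1..N. \<lfloor>a * real N ^ j\<rfloor> / real N ^ j) / N - a"

text \<open>For \<open>j \<le> k\<close>, \<open>q div N ^ (k - j)\<close> keeps the first
  \<open>j\<close> of the \<open>k\<close> digits of \<open>q\<close>. The formula thus depends on
  the slope only through the integer \<open>q\<close>, which leaves \<open>N ^ k\<close> centre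
  lines for all slopes in \<open>[0, 1)\<close>.\<close>

definition kakeya_centre :: "nat \<Rightarrow> nat \<Rightarrow> int \<Rightarrow> real \<Rightarrow> real" where
  "kakeya_centre N k q s = q / real N ^ k * (s - k / N) + (\<Sum>j=1..k. (q div int (N ^ (k - j))) / real N ^ j) / N"

lemma floor_div_power_bounds:
  assumes "0 < N"
  shows "\<lfloor>a * real N ^ j\<rfloor> / real N ^ j \<le> a" "a \<le> \<lfloor>a * real N ^ j\<rfloor> / real N ^ j + 1 / real N ^ j"
proof -
  have "0 < real N ^ j" using assms by simp
  then show "\<lfloor>a * real N ^ j\<rfloor> / real N ^ j \<le> a" "a \<le> \<lfloor>a * real N ^ j\<rfloor> / real N ^ j + 1 / real N ^ j"
    by (simp_all add: divide_le_eq le_divide_eq add_divide_distrib[symmetric])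
qed

lemma kakeya_intercept_bounds:
  assumes "0 < N" "0 \<le> a" "a < 1"
  shows "- 1 \<le> kakeya_intercept N a" "kakeya_intercept N a \<le> 0"
proof -
  have "0 \<le> (\<Sum>j=1..N. \<lfloor>a * real N ^ j\<rfloor> / real N ^ j) / N"
    using assms by (intro divide_nonneg_nonneg sum_nonneg) auto
  then show "- 1 \<le> kakeya_intercept N a" using assms by (simp add: kakeya_intercept_def)
  have "(\<Sum>j=1..N. \<lfloor>a * real N ^ j\<rfloor> / real N ^ j) \<le> (\<Sum>j=1..N. a)"
    by (intro sum_mono floor_div_power_bounds assms)
  then show "kakeya_intercept N a \<le> 0"
    using assms by (simp add: kakeya_intercept_def divide_le_eq mult.commute)
qed

text \<open>The difference is \<open>(a - T k) * (s - k / N)\<close> minus \<open>1 / N\<close>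
  times the sum of \<open>a - T j\<close> over \<open>k < j \<le> N\<close>. Both terms lie between
  0 and \<open>1 / N ^ (k + 1)\<close>: the factors of the first are at most
  \<open>1 / N ^ k\<close> and \<open>1 / N\<close>, and the second has at most \<open>N\<close>
  summands, each at most \<open>1 / N ^ (k + 1)\<close>.\<close>

lemma kakeya_line_near_centre:
  assumes N: "0 < N" and k: "k < N" and s: "k / N \<le> s" "s \<le> (k + 1) / N"
  shows "\<bar>a * s + kakeya_intercept N a - kakeya_centre N k \<lfloor>a * real N ^ k\<rfloor> s\<bar> \<le> 1 / real N ^ (k + 1)"
proof -
  define T where "T j = \<lfloor>a * real N ^ j\<rfloor> / real N ^ j" for j
  have Tle: "T j \<le> a" "a \<le> T j + 1 / real N ^ j" for j
    using floor_div_power_bounds[OF N] by (simp_all add: T_def)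
  have fl: "\<lfloor>a * real N ^ k\<rfloor> div int (N ^ (k - j)) = \<lfloor>a * real N ^ j\<rfloor>" if "j \<le> k" for j
  proof -
    have "real N ^ k = real N ^ j * real N ^ (k - j)" using that by (simp flip: power_add)
    then have "a * real N ^ j = a * real N ^ k / real_of_int (int (N ^ (k - j)))"
      using N by simp
    then show ?thesis by (simp only: floor_divide_real_eq_div of_nat_0_le_iff)
  qed
  have centre: "kakeya_centre N k \<lfloor>a * real N ^ k\<rfloor> s = T k * (s - k / N) + (\<Sum>j=1..k. T j) / N"
    by (simp add: kakeya_centre_def T_def fl del: of_nat_power)
  have "(\<Sum>j=1..N. T j) = (\<Sum>j=1..k. T j) + (\<Sum>j=k+1..N. T j)"
    using sum.ub_add_nat[of 1 k T "N - k"] k by simp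
  then have line: "a * s + kakeya_intercept N a = a * (s - 1) + (\<Sum>j=1..k. T j) / N + (\<Sum>j=k+1..N. T j) / N"
    by (simp add: kakeya_intercept_def T_def algebra_simps add_divide_distrib)
  define e where "e = 1 / real N ^ (k + 1)"
  have "(\<Sum>j=k+1..N. T j) \<le> (\<Sum>j=k+1..N. a)" by (intro sum_mono Tle)
  then have "(\<Sum>j=k+1..N. T j) \<le> (real N - k) * a" using k by (simp add: of_nat_diff)
  then have up: "(\<Sum>j=k+1..N. T j) / N \<le> a - a * (k / N)"
    using N by (simp add: field_simps)
  have "(\<Sum>j=k+1..N. a - e) \<le> (\<Sum>j=k+1..N. T j)"
  proof (intro sum_mono)
    fix j assume "j \<in> {k+1..N}"
    then have "1 / real N ^ j \<le> e" unfolding e_def using N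
      by (intro divide_left_mono power_increasing) auto
    with Tle(2)[of j] show "a - e \<le> T j" by linarith
  qed
  then have "(real N - k) * (a - e) \<le> (\<Sum>j=k+1..N. T j)" using k by (simp add: of_nat_diff)
  moreover have "(real N - k) * e \<le> real N * e" using N by (intro mult_right_mono) (auto simp: e_def)
  ultimately have "(real N - k) * a - real N * e \<le> (\<Sum>j=k+1..N. T j)" by (simp add: algebra_simps)
  then have "((real N - k) * a - real N * e) / N \<le> (\<Sum>j=k+1..N. T j) / N"
    by (rule divide_right_mono) simp
  moreover have "((real N - k) * a - real N * e) / N = a - a * (k / N) - e"
    using N by (simp add: field_simps)
  ultimately have lo: "a - a * (k / N) - e \<le> (\<Sum>j=k+1..N. T j) / N" by simp
  have d: "0 \<le> s - k / N" "s - k / N \<le> 1 / N" using s by (simp_all add: add_divide_distrib)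
  have "(a - T k) * (s - k / N) \<le> 1 / real N ^ k * (1 / N)"
    using d Tle[of k] by (intro mult_mono) auto
  then have "(a - T k) * (s - k / N) \<le> e" by (simp add: e_def mult.commute)
  moreover have "0 \<le> (a - T k) * (s - k / N)" using d Tle[of k] by simp
  moreover have "(a - T k) * (s - k / N) = a * s - a * (k / N) - T k * (s - k / N)"
    unfolding left_diff_distrib right_diff_distrib by simp
  moreover have "a * (s - 1) = a * s - a" by (simp add: algebra_simps)
  ultimately show ?thesis
    using up lo unfolding centre line e_def[symmetric] by linarith
qed

text \<open>Cut \<open>[0, 1]\<close> into \<open>M\<close> columns. In a column with
  \<open>k / N \<le> s \<le> (k + 1) / N\<close>, one box of height \<open>6 / N ^ (k + 1)\<close>
  around each of the \<open>N ^ k\<close> centre lines catches all the segments. The boxes of a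
  column have total area at most \<open>6 / (N * M)\<close>, so \<open>B\<close> has area at most
  \<open>6 / N\<close>.\<close>

lemma small_kakeya_neighbourhood:
  assumes "0 < \<epsilon>"
  obtains B :: "(real^2) set" and \<eta> :: real where "compact B" "0 < \<eta>" "\<eta> \<le> 1"
    "emeasure lebesgue B \<le> ennreal \<epsilon>"
    "\<And>a. \<lbrakk>0 \<le> a; a < 1\<rbrakk> \<Longrightarrow> \<exists>b. - 1 \<le> b \<and> b \<le> 0 \<and>
       (\<forall>z. 0 \<le> z $ 1 \<and> z $ 1 \<le> 1 \<and> \<bar>z $ 2 - a * z $ 1 - b\<bar> \<le> \<eta> \<longrightarrow> z \<in> B)"
proof -
  obtain N :: nat where N: "0 < N" "6 / N \<le> \<epsilon>"
  proof -
    obtain N :: nat where "6 / \<epsilon> < N" using reals_Archimedean2 by blast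
    moreover then have "0 < real N" using assms by (meson divide_pos_pos less_trans zero_less_numeral)
    ultimately show ?thesis using that[of N] assms by (simp add: field_simps)
  qed
  \<comment> \<open>As a multiple of \<open>N\<close>, \<open>M\<close> gives columns that do not
    straddle two blocks of width \<open>1 / N\<close>. Also
    \<open>1 / M \<le> 1 / N ^ (k + 1)\<close> for all \<open>k < N\<close>, so \<open>1 / M\<close>
    can serve as \<eta>.\<close>
  define M where "M = N ^ N"
  have M: "0 < M" and MN: "M = N * N ^ (N - 1)" using N by (simp_all add: M_def flip: power_Suc)
  define k where "k i = i div N ^ (N - 1)" for i
  define c where "c i q = kakeya_centre N (k i) q (i / M)" for i q
  \<comment> \<open>Three errors of at most \<open>1 / N ^ (k + 1)\<close> add up: the distance from
    the point to the line, from the line to its centre line, and the variation of the centre line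
    (slope at most 1) across the column.\<close>
  define h where "h i = 3 / real N ^ (k i + 1)" for i
  define box :: "nat \<Rightarrow> int \<Rightarrow> (real^2) set" where
    "box i q = cbox (vector [i / M, c i q - h i]) (vector [(i + 1) / M, c i q + h i])" for i q
  define Q where "Q i = {0..<int (N ^ k i)}" for i
  define B where "B = (\<Union>i<M. \<Union>q\<in>Q i. box i q)"
  have "compact B" unfolding B_def box_def Q_def by (intro compact_UN) auto
  have boxm: "emeasure lebesgue (box i q) = ennreal (2 * h i / M)" for i q
  proof -
    have "emeasure lebesgue (box i q) = ennreal (((real i + 1) / M - i / M) * (c i q + h i - (c i q - h i)))"
      unfolding box_def by (intro emeasure_lebesgue_cbox_vec2) (simp_all add: h_def divide_right_mono)
    also have "((real i + 1) / M - i / M) * (c i q + h i - (c i q - h i)) = 2 * h i / M"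
      by (simp add: add_divide_distrib)
    finally show ?thesis .
  qed
  have boxs: "box i q \<in> sets lebesgue" for i q by (simp add: box_def)
  have row: "emeasure lebesgue (\<Union>q\<in>Q i. box i q) \<le> ennreal (6 / (N * M))" for i
  proof -
    have "emeasure lebesgue (\<Union>q\<in>Q i. box i q) \<le> (\<Sum>q\<in>Q i. emeasure lebesgue (box i q))"
      by (intro emeasure_subadditive_finite) (auto simp: Q_def boxs)
    also have "\<dots> = ennreal (\<Sum>q\<in>Q i. 2 * h i / M)"
      unfolding boxm by (intro sum_ennreal) (simp add: h_def)
    also have "(\<Sum>q\<in>Q i. 2 * h i / M) = 6 / (N * M)"
      using N by (simp add: Q_def h_def)
    finally show ?thesis .
  qed
  have "emeasure lebesgue B \<le> (\<Sum>i<M. emeasure lebesgue (\<Union>q\<in>Q i. box i q))"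
    unfolding B_def by (intro emeasure_subadditive_finite) (auto simp: Q_def intro!: sets.finite_UN boxs)
  also have "\<dots> \<le> (\<Sum>i<M. ennreal (6 / (N * M)))" by (intro sum_mono row)
  also have "\<dots> = ennreal (\<Sum>i<M. 6 / (N * M))" by (intro sum_ennreal) simp
  also have "\<dots> = ennreal (6 / N)" using M by simp
  also have "\<dots> \<le> ennreal \<epsilon>" using N by (intro ennreal_leI)
  finally have Bm: "emeasure lebesgue B \<le> ennreal \<epsilon>" .
  have cover: "z \<in> B"
    if a: "0 \<le> a" "a < 1" and z: "0 \<le> z $ 1" "z $ 1 \<le> 1"
      and near: "\<bar>z $ 2 - a * z $ 1 - kakeya_intercept N a\<bar> \<le> 1 / M" for a z
  proof -
    \<comment> \<open>The right end point 1 would get the index \<open>M\<close>, so it is assigned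
      to the last column.\<close>
    define i where "i = (if z $ 1 = 1 then M - 1 else nat \<lfloor>z $ 1 * M\<rfloor>)"
    have i: "i < M" "i / M \<le> z $ 1" "z $ 1 \<le> (i + 1) / M"
    proof -
      have "i < M \<and> i \<le> z $ 1 * M \<and> z $ 1 * M \<le> i + 1"
      proof (cases "z $ 1 = 1")
        case True
        then show ?thesis using M by (simp add: i_def of_nat_diff)
      next
        case False
        then have "z $ 1 * M < M" using z M by simp
        moreover have "0 \<le> z $ 1 * M" using z by simp
        moreover have "real i = \<lfloor>z $ 1 * M\<rfloor>" using z False by (simp add: i_def)
        ultimately show ?thesis by linarith
      qed
      then show "i < M" "i / M \<le> z $ 1" "z $ 1 \<le> (i + 1) / M"
        using M by (simp_all add: divide_le_eq le_divide_eq)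
    qed
    define q where "q = \<lfloor>a * real N ^ k i\<rfloor>"
    have k: "k i < N" using i(1) unfolding k_def MN by (simp add: less_mult_imp_div_less)
    have ki: "k i * N ^ (N - 1) \<le> i" "i + 1 \<le> (k i + 1) * N ^ (N - 1)"
      unfolding k_def using N by (simp_all add: Suc_leI dividend_less_div_times)
    have "real (k i) / N = real (k i * N ^ (N - 1)) / M" using N by (simp add: MN)
    also have "\<dots> \<le> i / M" using ki(1) by (intro divide_right_mono) linarith+
    finally have s1: "k i / N \<le> i / M" .
    have "real (i + 1) / M \<le> real ((k i + 1) * N ^ (N - 1)) / M"
      using ki(2) by (intro divide_right_mono of_nat_mono) auto
    also have "\<dots> = (k i + 1) / N" unfolding MN of_nat_mult using N by simp
    finally have s2: "(i + 1) / M \<le> (k i + 1) / N" by (simp add: add.commute)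
    have q: "q \<in> Q i" using a N
      by (auto simp: Q_def q_def floor_less_iff mult_less_cancel_right1)
    define e where "e = 1 / real N ^ (k i + 1)"
    have "real N ^ (k i + 1) \<le> real N ^ N" using N k by (intro power_increasing) auto
    then have Me: "1 / M \<le> e" unfolding e_def M_def of_nat_power using N by (intro divide_left_mono) auto
    have "\<bar>a * z $ 1 + kakeya_intercept N a - kakeya_centre N (k i) q (z $ 1)\<bar> \<le> e"
      unfolding q_def e_def using N k i s1 s2 by (intro kakeya_line_near_centre) auto
    moreover have "kakeya_centre N (k i) q (z $ 1) - c i q = q / real N ^ k i * (z $ 1 - i / M)"
      by (simp add: kakeya_centre_def c_def algebra_simps)
    moreover have "\<bar>q / real N ^ k i * (z $ 1 - i / M)\<bar> \<le> 1 * (1 / M)"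
    proof -
      have "0 \<le> q / real N ^ k i" "q / real N ^ k i \<le> 1"
        using q N by (auto simp: Q_def divide_le_eq) (metis of_int_le_iff of_int_of_nat_eq of_nat_power less_imp_le)
      then show ?thesis unfolding abs_mult
        using i by (intro mult_mono) (auto simp: add_divide_distrib)
    qed
    ultimately have "\<bar>z $ 2 - c i q\<bar> \<le> 3 * e" using near Me by linarith
    then have "z \<in> box i q" using i
      by (auto simp: box_def mem_box_cart forall_2 h_def e_def abs_le_iff add.commute)
    then show ?thesis using i(1) q by (auto simp: B_def)
  qed
  show ?thesis
  proof (rule that[OF \<open>compact B\<close> _ _ Bm])
    show "0 < 1 / real M" "1 / real M \<le> 1" using M by auto
    fix a :: real assume "0 \<le> a" "a < 1"
    then show "\<exists>b. - 1 \<le> b \<and> b \<le> 0 \<and>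
       (\<forall>z. 0 \<le> z $ 1 \<and> z $ 1 \<le> 1 \<and> \<bar>z $ 2 - a * z $ 1 - b\<bar> \<le> 1 / real M \<longrightarrow> z \<in> B)"
      using kakeya_intercept_bounds[OF N(1)] cover by blast
  qed
qed

section \<open>The counterexample\<close>

text \<open>The circle about \<open>(- r a, r)\<close> through the left end
  \<open>(0, \<rho> b)\<close> of the scaled segment is only nearly tangent to it: its slope there
  is \<open>r a / (r - \<rho> b)\<close> instead of \<open>a\<close>, an error O(\<rho>). Along an
  arc of length O(\<rho>) this error and the curvature each contribute
  O(\<open>\<rho>\<^sup>2\<close>).\<close>

lemma tangent_arc_near_line:
  assumes \<rho>: "0 < \<rho>" "\<rho> \<le> 1" and r: "2 \<le> r" "r \<le> 3" and a: "0 \<le> a" "a \<le> 1" and b: "- 1 \<le> b" "b \<le> 0"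
  obtains t \<phi>\<^sub>0 where "0 < t" "t \<le> 7" "0 \<le> \<phi>\<^sub>0" "\<phi>\<^sub>0 \<le> pi"
    "\<And>\<tau> z. \<lbrakk>0 \<le> \<tau>; \<tau> \<le> \<rho> / 4; z = vector [- (r * a), r] - t *\<^sub>R circle_point (\<phi>\<^sub>0 + \<tau>)\<rbrakk> \<Longrightarrow>
       0 \<le> z $ 1 \<and> z $ 1 \<le> \<rho> \<and> \<bar>z $ 2 - a * z $ 1 - \<rho> * b\<bar> \<le> \<rho>\<^sup>2"
proof -
  define t where "t = sqrt ((r * a)\<^sup>2 + (r - \<rho> * b)\<^sup>2)"
  have \<rho>b: "0 \<le> - (\<rho> * b)" "- (\<rho> * b) \<le> \<rho>"
    using \<rho> b mult_left_mono[of "- 1" b \<rho>] by (simp_all add: mult_nonneg_nonpos)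
  have ra: "0 \<le> r * a" "r * a \<le> r" using r a by (simp_all add: mult_left_le)
  have "(r - \<rho> * b)\<^sup>2 > 0" using r \<rho>b by simp
  then have t2: "0 < (r * a)\<^sup>2 + (r - \<rho> * b)\<^sup>2" by (simp add: add_nonneg_pos)
  then have t: "0 < t" "t\<^sup>2 = (r * a)\<^sup>2 + (r - \<rho> * b)\<^sup>2" by (simp_all add: t_def)
  have "t \<le> \<bar>r * a\<bar> + \<bar>r - \<rho> * b\<bar>" unfolding t_def by (rule sqrt_sum_squares_le_sum_abs)
  then have "t \<le> 7" using r \<rho> ra \<rho>b by linarith
  have "(- (r * a) / t)\<^sup>2 + ((r - \<rho> * b) / t)\<^sup>2 = 1"
    unfolding power_divide power2_minus add_divide_distrib[symmetric] t(2)[symmetric] using t(1) by simp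
  moreover have "0 \<le> (r - \<rho> * b) / t" using t r \<rho>b by simp
  ultimately obtain \<phi>\<^sub>0 where \<phi>: "0 \<le> \<phi>\<^sub>0" "\<phi>\<^sub>0 \<le> pi" "- (r * a) / t = cos \<phi>\<^sub>0" "(r - \<rho> * b) / t = sin \<phi>\<^sub>0"
    using sincos_total_pi by metis
  then have cs: "t * cos \<phi>\<^sub>0 = - (r * a)" "t * sin \<phi>\<^sub>0 = r - \<rho> * b"
    using t by (simp_all flip: \<phi>(3,4))
  show ?thesis
  proof (rule that[OF t(1) \<open>t \<le> 7\<close> \<phi>(1,2)])
    fix \<tau> :: real and z :: "real^2"
    assume \<tau>: "0 \<le> \<tau>" "\<tau> \<le> \<rho> / 4" and z: "z = vector [- (r * a), r] - t *\<^sub>R circle_point (\<phi>\<^sub>0 + \<tau>)"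
    define s where "s = sin \<tau>"
    define d where "d = 1 - cos \<tau>"
    have "z $ 1 = - (r * a) - (t * cos \<phi>\<^sub>0) * cos \<tau> + (t * sin \<phi>\<^sub>0) * sin \<tau>"
      by (simp add: z cos_add algebra_simps)
    then have z1: "z $ 1 = (r - \<rho> * b) * s - (r * a) * d"
      unfolding cs by (simp add: s_def d_def algebra_simps)
    have "z $ 2 = r - (t * sin \<phi>\<^sub>0) * cos \<tau> - (t * cos \<phi>\<^sub>0) * sin \<tau>"
      by (simp add: z sin_add algebra_simps)
    then have z2: "z $ 2 = \<rho> * b + (r - \<rho> * b) * d + (r * a) * s"
      unfolding cs by (simp add: s_def d_def algebra_simps)
    have "\<tau> \<le> pi / 2" using \<tau> \<rho> pi_gt3 by linarith
    then have "0 \<le> s" "0 \<le> cos \<tau>" unfolding s_def using \<tau> by (auto intro!: sin_ge_zero cos_ge_zero)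
    have "s \<le> \<tau>" unfolding s_def using \<tau> by (intro sin_x_le_x)
    have "0 \<le> d" by (simp add: d_def)
    have "d \<le> \<tau>\<^sup>2 / 2"
    proof -
      have "(sin (\<tau> / 2))\<^sup>2 \<le> (\<tau> / 2)\<^sup>2"
        using \<tau> \<open>\<tau> \<le> pi / 2\<close> by (intro power_mono sin_x_le_x sin_ge_zero) auto
      moreover have "d = 2 * (sin (\<tau> / 2))\<^sup>2"
        using cos_double_sin[of "\<tau> / 2"] by (simp add: d_def)
      ultimately show ?thesis by (simp add: power_divide)
    qed
    moreover have "\<tau>\<^sup>2 \<le> (\<rho> / 4)\<^sup>2" using \<tau> by (intro power_mono)
    ultimately have d: "d \<le> \<rho>\<^sup>2 / 32" by (simp add: power_divide)
    have s: "s \<le> \<rho> / 4" using \<open>s \<le> \<tau>\<close> \<tau> by simp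
    \<comment> \<open>With sine and cosine in \<open>[0, 1]\<close>, the identity
      \<open>sin\<^sup>2 + cos\<^sup>2 = 1\<close> gives \<open>1 \<le> sin + cos\<close>. This
      keeps the arc to the right of the vertical axis.\<close>
    have "d \<le> s"
    proof -
      have "cos \<tau> * cos \<tau> \<le> cos \<tau> * 1" "s * s \<le> s * 1"
        using \<open>0 \<le> s\<close> \<open>0 \<le> cos \<tau>\<close> by (intro mult_left_mono; simp add: s_def)+
      then show ?thesis using sin_cos_squared_add[of \<tau>] by (simp add: d_def s_def power2_eq_square)
    qed
    have "(r * a) * d \<le> r * s" using ra \<open>d \<le> s\<close> \<open>0 \<le> d\<close> r by (intro mult_mono) auto
    moreover have "r * s \<le> (r - \<rho> * b) * s" using \<open>0 \<le> s\<close> \<rho>b by (intro mult_right_mono) auto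
    ultimately have low: "0 \<le> z $ 1" by (simp add: z1)
    \<comment> \<open>The factor \<open>r - \<rho> * b\<close> is at most 4, hence the angular
      length \<open>\<rho> / 4\<close>.\<close>
    have "(r - \<rho> * b) * s \<le> 4 * (\<rho> / 4)" using s \<open>0 \<le> s\<close> r \<rho> \<rho>b by (intro mult_mono) auto
    moreover have "0 \<le> (r * a) * d" using ra \<open>0 \<le> d\<close> by simp
    ultimately have high: "z $ 1 \<le> \<rho>" by (simp add: z1)
    \<comment> \<open>The term with \<open>d\<close> comes from the curvature, the term with
      \<open>s\<close> from the error in the slope.\<close>
    have eq: "z $ 2 - a * z $ 1 - \<rho> * b = (r - \<rho> * b + a * (r * a)) * d - a * (- (\<rho> * b)) * s"
      by (simp add: z1 z2 algebra_simps)
    have ara: "0 \<le> a * (r * a)" using a ra by simp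
    have ara': "a * (r * a) \<le> 1 * 3" using a ra(1) order_trans[OF ra(2) r(2)] by (intro mult_mono) simp_all
    have "(r - \<rho> * b + a * (r * a)) * d \<le> 7 * (\<rho>\<^sup>2 / 32)"
      using d \<open>0 \<le> d\<close> r \<rho> \<rho>b ara ara' by (intro mult_mono) auto
    moreover have "0 \<le> (r - \<rho> * b + a * (r * a)) * d"
      using \<open>0 \<le> d\<close> r \<rho>b ara by (intro mult_nonneg_nonneg) auto
    moreover have "a * (- (\<rho> * b)) * s \<le> (1 * \<rho>) * (\<rho> / 4)"
      using a \<rho>b s \<open>0 \<le> s\<close> \<rho> by (intro mult_mono mult_nonneg_nonneg) auto
    moreover have "0 \<le> a * (- (\<rho> * b)) * s"
      using a \<rho>b \<open>0 \<le> s\<close> by (intro mult_nonneg_nonneg) auto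
    moreover have "0 \<le> \<rho>\<^sup>2" by simp
    ultimately have "\<bar>z $ 2 - a * z $ 1 - \<rho> * b\<bar> \<le> \<rho>\<^sup>2"
      unfolding eq by (simp add: power2_eq_square abs_le_iff)
    with low high show "0 \<le> z $ 1 \<and> z $ 1 \<le> \<rho> \<and> \<bar>z $ 2 - a * z $ 1 - \<rho> * b\<bar> \<le> \<rho>\<^sup>2" by simp
  qed
qed

text \<open>The same \<rho> is the width of the neighbourhood in \<open>B\<close> and the factor of
  dilation. The dilated width is \<open>\<rho>\<^sup>2\<close>, exactly the error in
  \<open>tangent_arc_near_line\<close>, and the area also gains
  \<open>\<rho>\<^sup>2\<close>.\<close>

lemma kakeya_bump:
  assumes "0 < \<epsilon>"
  obtains \<rho> and f :: "real^2 \<Rightarrow> real" where "0 < \<rho>" "\<rho> \<le> 1" "continuous_on UNIV f" "\<And>z. 0 \<le> f z" "\<And>z. f z \<le> 1"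
    "emeasure lebesgue {z. f z \<noteq> 0} \<le> ennreal (\<rho>\<^sup>2 * \<epsilon>)"
    "\<And>\<theta> g x. \<lbrakk>continuous_on UNIV g; \<And>z. 0 \<le> g z; \<And>z. norm z \<le> 13 \<Longrightarrow> g z = 1;
       x \<in> cbox (vector [- 1, 2]) (vector [0, 3])\<rbrakk> \<Longrightarrow>
      ennreal (\<rho> / 4) \<le> circular_maximal \<theta> (\<lambda>z. of_real (f z)) (\<lambda>z. of_real (g z)) x"
proof -
  obtain B :: "(real^2) set" and \<rho> :: real where B: "compact B" "0 < \<rho>" "\<rho> \<le> 1"
    "emeasure lebesgue B \<le> ennreal (\<epsilon> / 2)"
    and line: "\<And>a. \<lbrakk>0 \<le> a; a < 1\<rbrakk> \<Longrightarrow> \<exists>b. - 1 \<le> b \<and> b \<le> 0 \<and>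
       (\<forall>z. 0 \<le> z $ 1 \<and> z $ 1 \<le> 1 \<and> \<bar>z $ 2 - a * z $ 1 - b\<bar> \<le> \<rho> \<longrightarrow> z \<in> B)"
    by (rule small_kakeya_neighbourhood[of "\<epsilon> / 2"]) (use assms in auto)
  have lt: "emeasure lebesgue B < ennreal \<epsilon>"
    by (rule order_le_less_trans[OF B(4)]) (use assms in \<open>simp add: ennreal_less_iff\<close>)
  obtain F :: "real^2 \<Rightarrow> real" where F: "continuous_on UNIV F" "\<And>x. 0 \<le> F x" "\<And>x. F x \<le> 1"
    "\<And>x. x \<in> B \<Longrightarrow> F x = 1" "emeasure lebesgue {x. F x \<noteq> 0} \<le> ennreal \<epsilon>"
    by (rule compact_bump[OF B(1) lt]) blast
  define f where "f z = F (z /\<^sub>R \<rho>)" for z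
  have cf: "continuous_on UNIV f" unfolding f_def
    by (intro continuous_on_compose2[OF F(1)] continuous_intros) auto
  have "{z. f z \<noteq> 0} = (\<lambda>z. \<rho> *\<^sub>R z + 0) ` {z. F z \<noteq> 0}"
  proof (intro set_eqI iffI)
    fix z assume "z \<in> {z. f z \<noteq> 0}"
    then show "z \<in> (\<lambda>z. \<rho> *\<^sub>R z + 0) ` {z. F z \<noteq> 0}"
      using B(2) by (intro image_eqI[where x = "z /\<^sub>R \<rho>"]) (auto simp: f_def)
  next
    fix z assume "z \<in> (\<lambda>z. \<rho> *\<^sub>R z + 0) ` {z. F z \<noteq> 0}"
    then show "z \<in> {z. f z \<noteq> 0}" using B(2) by (auto simp: f_def)
  qed
  then have "emeasure lebesgue {z. f z \<noteq> 0} = ennreal (\<rho>\<^sup>2) * emeasure lebesgue {z. F z \<noteq> 0}"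
    by (simp only: emeasure_lebesgue_affine) simp
  also have "\<dots> \<le> ennreal (\<rho>\<^sup>2) * ennreal \<epsilon>" by (intro mult_left_mono F) auto
  finally have fm: "emeasure lebesgue {z. f z \<noteq> 0} \<le> ennreal (\<rho>\<^sup>2 * \<epsilon>)"
    using assms by (simp add: ennreal_mult)
  show ?thesis
  proof (rule that[OF B(2,3) cf _ _ fm])
    show "0 \<le> f z" "f z \<le> 1" for z using F by (simp_all add: f_def)
    fix \<theta> and g :: "real^2 \<Rightarrow> real" and x :: "real^2"
    assume g: "continuous_on UNIV g" "\<And>z. 0 \<le> g z" "\<And>z. norm z \<le> 13 \<Longrightarrow> g z = 1"
      and x: "x \<in> cbox (vector [- 1, 2]) (vector [0, 3])"
    have x12: "- 1 \<le> x $ 1" "x $ 1 \<le> 0" "2 \<le> x $ 2" "x $ 2 \<le> 3"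
      using x by (auto simp: mem_box_cart forall_2)
    \<comment> \<open>The slope of the direction orthogonal to \<open>x\<close>.\<close>
    define a where "a = - x $ 1 / x $ 2"
    have a: "0 \<le> a" "a < 1" using x12 by (simp_all add: a_def divide_less_eq divide_le_0_iff less_divide_eq)
    have xa: "x = vector [- (x $ 2 * a), x $ 2]" using x12 by (simp add: a_def vec_eq_iff forall_2)
    obtain b where b: "- 1 \<le> b" "b \<le> 0"
      and bB: "\<And>z. \<lbrakk>0 \<le> z $ 1; z $ 1 \<le> 1; \<bar>z $ 2 - a * z $ 1 - b\<bar> \<le> \<rho>\<rbrakk> \<Longrightarrow> z \<in> B"
      using line[OF a] by blast
    obtain t \<phi>\<^sub>0 where t: "0 < t" "t \<le> 7" and \<phi>: "0 \<le> \<phi>\<^sub>0" "\<phi>\<^sub>0 \<le> pi"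
      and arc: "\<And>\<tau> z. \<lbrakk>0 \<le> \<tau>; \<tau> \<le> \<rho> / 4; z = vector [- (x $ 2 * a), x $ 2] - t *\<^sub>R circle_point (\<phi>\<^sub>0 + \<tau>)\<rbrakk> \<Longrightarrow>
         0 \<le> z $ 1 \<and> z $ 1 \<le> \<rho> \<and> \<bar>z $ 2 - a * z $ 1 - \<rho> * b\<bar> \<le> \<rho>\<^sup>2"
      using tangent_arc_near_line[OF B(2,3) x12(3,4) a(1) less_imp_le[OF a(2)] b] by metis
    have "\<phi>\<^sub>0 + \<rho> / 4 - \<phi>\<^sub>0 \<le> arc_average \<theta> t f g x"
    proof (rule arc_average_ge[OF cf g(1) _ g(2)])
      show "0 \<le> f z" for z using F by (simp add: f_def)
      show "\<phi>\<^sub>0 + \<rho> / 4 \<le> 2 * pi" using \<phi> B(2,3) pi_gt3 by linarith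
      show "0 \<le> \<phi>\<^sub>0" "\<phi>\<^sub>0 \<le> \<phi>\<^sub>0 + \<rho> / 4" using \<phi> B(2) by auto
    next
      fix \<psi> assume "\<phi>\<^sub>0 \<le> \<psi>" "\<psi> \<le> \<phi>\<^sub>0 + \<rho> / 4"
      define z where "z = x - t *\<^sub>R circle_point \<psi>"
      have z: "0 \<le> z $ 1 \<and> z $ 1 \<le> \<rho> \<and> \<bar>z $ 2 - a * z $ 1 - \<rho> * b\<bar> \<le> \<rho>\<^sup>2"
        by (rule arc[of "\<psi> - \<phi>\<^sub>0"]) (use \<open>\<phi>\<^sub>0 \<le> \<psi>\<close> \<open>\<psi> \<le> \<phi>\<^sub>0 + \<rho> / 4\<close> xa in \<open>auto simp: z_def\<close>)
      have "z /\<^sub>R \<rho> \<in> B"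
      proof (rule bB)
        show "0 \<le> (z /\<^sub>R \<rho>) $ 1" "(z /\<^sub>R \<rho>) $ 1 \<le> 1"
          using z B(2) by (simp_all add: inverse_eq_divide divide_le_eq)
        have "(z /\<^sub>R \<rho>) $ 2 - a * (z /\<^sub>R \<rho>) $ 1 - b = (z $ 2 - a * z $ 1 - \<rho> * b) / \<rho>"
          using B(2) by (simp add: field_simps)
        then show "\<bar>(z /\<^sub>R \<rho>) $ 2 - a * (z /\<^sub>R \<rho>) $ 1 - b\<bar> \<le> \<rho>"
          using z B(2) by (simp add: abs_divide divide_le_eq power2_eq_square)
      qed
      then show "f (x - t *\<^sub>R circle_point \<psi>) = 1" using F(4) by (simp add: f_def z_def)
    next
      fix \<psi>
      have "norm (x - t *\<^sub>R circle_point \<psi>) \<le> norm x + norm (t *\<^sub>R circle_point \<psi>)"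
        by (rule norm_triangle_ineq4)
      \<comment> \<open>The right-hand side is at most 4 + 7, so the whole circle lies in the ball
        of radius 13 where \<open>g\<close> is 1.\<close>
      also have "\<dots> \<le> (\<bar>x $ 1\<bar> + \<bar>x $ 2\<bar>) + t"
        using norm_le_l1_cart[of x] t by (simp add: norm_circle_point UNIV_2)
      finally show "g (x - t *\<^sub>R circle_point \<psi>) = 1" using x12 t by (intro g(3)) linarith
    qed
    then have "ennreal (\<rho> / 4) \<le> ennreal \<bar>arc_average \<theta> t f g x\<bar>"
      by (intro ennreal_leI) linarith
    also have "\<dots> \<le> circular_maximal \<theta> (\<lambda>z. of_real (f z)) (\<lambda>z. of_real (g z)) x"
      using t(1) by (auto simp: circular_maximal_def circular_average_of_real[OF cf g(1)] intro!: SUP_upper2[where i = t])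
    finally show "ennreal (\<rho> / 4) \<le> circular_maximal \<theta> (\<lambda>z. of_real (f z)) (\<lambda>z. of_real (g z)) x" .
  qed
qed

text \<open>The bounds for the norm of \<open>f\<close> and for the maximal function are both
  proportional to \<rho>, which cancels. So \<open>e\<close> can be fixed from \<open>C\<close>,
  \<open>g\<close> and \<open>p\<close> before \<open>f\<close> is built, although nothing bounds
  the resulting \<rho> from below.\<close>

lemma lorentz_endpoint_counterexample:
  fixes p1 p2 p :: ennreal
  assumes p1: "1 < p1" "p1 \<le> 2" and p2: "0 < p2" and p: "p < \<infinity>"
  obtains f g :: "real^2 \<Rightarrow> real" where
    "continuous_on UNIV f" "continuous_on UNIV g"
    "(\<lambda>z. of_real (f z)) \<in> lorentz_space lebesgue p1 1"
    "(\<lambda>z. of_real (g z)) \<in> lorentz_space lebesgue p2 1"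
    "ennreal C * lorentz_norm lebesgue p1 1 (\<lambda>z. ennreal \<bar>f z\<bar>) * lorentz_norm lebesgue p2 1 (\<lambda>z. ennreal \<bar>g z\<bar>)
      < lorentz_norm lebesgue p \<infinity> (circular_maximal \<theta> (\<lambda>z. of_real (f z)) (\<lambda>z. of_real (g z)))"
proof -
  have mem: "(\<lambda>z. of_real (h z)) \<in> lorentz_space lebesgue r 1"
    if "continuous_on UNIV h" "\<And>z. 0 \<le> h z" "\<And>z. h z \<le> 1" "emeasure lebesgue {z. h z \<noteq> 0} < \<infinity>" "0 < r"
    for h :: "real^2 \<Rightarrow> real" and r
  proof -
    have "h \<in> borel_measurable borel" using that(1) by (rule borel_measurable_continuous_onI)
    then have "(\<lambda>z. complex_of_real (h z)) \<in> borel_measurable lebesgue"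
      by (intro measurable_completion) simp
    then show ?thesis using lorentz_norm_bump_finite[OF that] that(2) by (simp add: lorentz_space_def)
  qed
  have "emeasure lebesgue (cball (0::real^2) 13) < \<infinity>"
    using emeasure_compact_finite[OF compact_cball, of 0 13] by simp
  then obtain m' where m': "0 \<le> m'" "emeasure lebesgue (cball (0::real^2) 13) = ennreal m'"
    by (cases "emeasure lebesgue (cball (0::real^2) 13)") auto
  then have lt: "emeasure lebesgue (cball (0::real^2) 13) < ennreal (m' + 1)" by (simp add: ennreal_less_iff)
  obtain g :: "real^2 \<Rightarrow> real" where g: "continuous_on UNIV g" "\<And>x. 0 \<le> g x" "\<And>x. g x \<le> 1"
    "\<And>x. x \<in> cball 0 13 \<Longrightarrow> g x = 1" "emeasure lebesgue {x. g x \<noteq> 0} \<le> ennreal (m' + 1)"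
    by (rule compact_bump[OF compact_cball lt]) blast
  have gm: "emeasure lebesgue {x. g x \<noteq> 0} < \<infinity>" using g(5) by (simp add: order_le_less_trans)
  have "lorentz_norm lebesgue p2 1 (\<lambda>z. ennreal (g z)) < \<infinity>"
    by (rule lorentz_norm_bump_finite[OF g(1-3) gm p2])
  then obtain G where G: "0 \<le> G" "lorentz_norm lebesgue p2 1 (\<lambda>z. ennreal (g z)) = ennreal G"
    by (cases "lorentz_norm lebesgue p2 1 (\<lambda>z. ennreal (g z))") auto
  \<comment> \<open>\<open>ennreal\<close> sends a negative \<open>C\<close> to 0.\<close>
  define D where "D = max 0 C"
  \<comment> \<open>The weak norm is tested at \<open>t = 1 / 2\<close> on a square of area 1, where
    the maximal function is at least \<open>\<rho> / 4\<close>.\<close>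
  define \<delta> where "\<delta> = (1 / 2) powr (1 / enn2real p) / 4"
  define e where "e = min 1 (\<delta> / (2 * D * G + 1))"
  have \<delta>: "0 < \<delta>" by (simp add: \<delta>_def)
  have D: "0 \<le> D" by (simp add: D_def)
  with G have DG: "0 \<le> D * G" by simp
  have e: "0 < e" "e \<le> 1" using \<delta> DG by (simp_all add: e_def add_nonneg_pos)
  have "e \<le> \<delta> / (2 * D * G + 1)" by (simp add: e_def)
  then have "e * (2 * D * G + 1) \<le> \<delta>" using DG by (simp add: pos_le_divide_eq add_nonneg_pos)
  then have eDG: "2 * D * G * e < \<delta>" using e by (simp add: algebra_simps)
  obtain \<rho> and f :: "real^2 \<Rightarrow> real" where \<rho>: "0 < \<rho>" "\<rho> \<le> 1"
    and f: "continuous_on UNIV f" "\<And>z. 0 \<le> f z" "\<And>z. f z \<le> 1"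
    "emeasure lebesgue {z. f z \<noteq> 0} \<le> ennreal (\<rho>\<^sup>2 * e\<^sup>2)"
    and big: "\<And>\<theta> g x. \<lbrakk>continuous_on UNIV g; \<And>z. 0 \<le> g z; \<And>z. norm z \<le> 13 \<Longrightarrow> g z = 1;
       x \<in> cbox (vector [- 1, 2]) (vector [0, 3])\<rbrakk> \<Longrightarrow>
      ennreal (\<rho> / 4) \<le> circular_maximal \<theta> (\<lambda>z. of_real (f z)) (\<lambda>z. of_real (g z)) x"
    by (rule kakeya_bump[OF zero_less_power[OF e(1), of 2]]) blast
  have fm: "emeasure lebesgue {z. f z \<noteq> 0} < \<infinity>" using f(4) by (simp add: order_le_less_trans)
  have p1': "p1 < \<infinity>" "0 < p1" 
    using order_le_less_trans[OF p1(2)] order_less_trans[OF zero_less_one p1(1)] by simp_all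
  define q where "q = enn2real p1"
  have q: "1 < q" "q \<le> 2"
    using p1 p1' enn2real_mono[of p1 2] by (cases p1; simp add: q_def)+
  define m where "m = (\<rho> * e)\<^sup>2"
  have \<rho>e: "0 < \<rho> * e" "\<rho> * e \<le> 1" using \<rho> e by (simp_all add: mult_le_one)
  then have m: "0 < m" "m \<le> 1" unfolding m_def by (intro zero_less_power power_le_one; simp)+
  \<comment> \<open>Here \<open>p1 \<le> 2\<close> enters: as \<open>m \<le> 1\<close>, the power
    with exponent \<open>1 / q \<ge> 1 / 2\<close> is at most the square root.\<close>
  have "m powr (1 / q) \<le> m powr (1 / 2)" using m q by (intro powr_mono') (auto simp: field_simps)
  also have "\<dots> = \<rho> * e" using \<rho>e by (simp add: m_def powr_half_sqrt)
  finally have mq: "q * m powr (1 / q) \<le> 2 * (\<rho> * e)" using q by (intro mult_mono) auto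
  have "{z \<in> space lebesgue. ennreal (f z) > 0} = {z. f z \<noteq> 0}" using f(2) by (auto simp: less_le)
  then have "lorentz_norm lebesgue p1 1 (\<lambda>z. ennreal (f z)) \<le> ennreal (q * m powr (1 / q))"
    unfolding q_def using f p1' m by (intro lorentz_norm_1_le) (auto simp: m_def power_mult_distrib)
  also have "\<dots> \<le> ennreal (2 * (\<rho> * e))" using mq by (rule ennreal_leI)
  finally have fn: "lorentz_norm lebesgue p1 1 (\<lambda>z. ennreal (f z)) \<le> ennreal (2 * (\<rho> * e))" .
  have "ennreal C * lorentz_norm lebesgue p1 1 (\<lambda>z. ennreal \<bar>f z\<bar>) * lorentz_norm lebesgue p2 1 (\<lambda>z. ennreal \<bar>g z\<bar>)
      \<le> ennreal D * ennreal (2 * (\<rho> * e)) * ennreal G"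
    using fn f(2) g(2) G by (intro mult_mono) (auto simp: D_def ennreal_leI)
  also have "\<dots> = ennreal (D * (2 * (\<rho> * e)) * G)"
    using G(1) \<rho>e D by (simp add: ennreal_mult del: mult_le_0_iff zero_le_mult_iff)
  also have "D * (2 * (\<rho> * e)) * G = \<rho> * (2 * D * G * e)" by (simp add: ac_simps)
  also have "\<dots> < ennreal (\<rho> * \<delta>)"
    using eDG \<rho>(1) \<delta> by (intro ennreal_lessI) auto
  also have "\<dots> = ennreal ((1 / 2) powr (1 / enn2real p)) * ennreal (\<rho> / 4)"
    using \<rho> by (simp add: \<delta>_def flip: ennreal_mult)
  also have "\<dots> \<le> lorentz_norm lebesgue p \<infinity> (circular_maximal \<theta> (\<lambda>z. of_real (f z)) (\<lambda>z. of_real (g z)))"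
  proof (rule lorentz_norm_weak_ge[OF p])
    show "{x \<in> space lebesgue. \<alpha> < circular_maximal \<theta> (\<lambda>z. of_real (f z)) (\<lambda>z. of_real (g z)) x} \<in> sets lebesgue" for \<alpha>
      using open_circular_maximal_superlevel[OF f(1) g(1)] by simp
    show "ennreal (\<rho> / 4) \<le> circular_maximal \<theta> (\<lambda>z. of_real (f z)) (\<lambda>z. of_real (g z)) x"
      if "x \<in> cbox (vector [- 1, 2]) (vector [0, 3])" for x
      by (rule big) (use that g in auto)
    show "ennreal (1 / 2) < emeasure lebesgue (cbox (vector [- 1, 2]) (vector [0, 3]) :: (real^2) set)"
    proof -
      have "emeasure lebesgue (cbox (vector [- 1, 2]) (vector [0, 3]) :: (real^2) set) = ennreal 1"
        by (subst emeasure_lebesgue_cbox_vec2) simp_all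
      then show ?thesis by (simp only:) (rule ennreal_lessI; simp)
    qed
  qed auto
  finally show ?thesis
    using that[OF f(1) g(1) mem[OF f(1-3) fm p1'(2)] mem[OF g(1-3) gm p2]] by blast
qed

theorem theorem1p12:
  fixes \<theta> :: real
  assumes "0 < \<theta>" and "\<theta> < 2 * pi"
  shows "(\<forall>p1 p2 p :: ennreal.
            1 < p1 \<and> 1 < p2 \<and> 1 / p1 + 1 / p2 = 1 / p \<and> (p1 \<le> 2 \<or> p2 \<le> 2) \<longrightarrow>
              \<not> lorentz_bounded (circular_maximal \<theta>) (p1, 1) (p2, 1) (p, \<infinity>))
         \<and> \<not> lorentz_bounded (circular_maximal \<theta>) (2, 1) (2, 1) (1, \<infinity>)"
proof -
  have main: "\<not> lorentz_bounded (circular_maximal \<theta>) (p1, 1) (p2, 1) (p, \<infinity>)"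
    if p12: "1 < p1" "1 < p2" and p: "p < \<infinity>" and le2: "p1 \<le> 2 \<or> p2 \<le> 2" for p1 p2 p :: ennreal
  proof
    assume "lorentz_bounded (circular_maximal \<theta>) (p1, 1) (p2, 1) (p, \<infinity>)"
    then obtain C where C: "\<And>f g. f \<in> lorentz_space lebesgue p1 1 \<Longrightarrow> g \<in> lorentz_space lebesgue p2 1 \<Longrightarrow>
      lorentz_norm lebesgue p \<infinity> (circular_maximal \<theta> f g) \<le>
        ennreal C * lorentz_norm lebesgue p1 1 (\<lambda>x. ennreal (norm (f x)))
                  * lorentz_norm lebesgue p2 1 (\<lambda>x. ennreal (norm (g x)))"
      unfolding lorentz_bounded_def by auto
    have pos: "0 < p1" "0 < p2" 
      using order_less_trans[OF zero_less_one p12(1)] order_less_trans[OF zero_less_one p12(2)] .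
    from le2 show False
    proof
      assume "p1 \<le> 2"
      obtain f g :: "real^2 \<Rightarrow> real" where fg:
        "(\<lambda>z. of_real (f z)) \<in> lorentz_space lebesgue p1 1"
        "(\<lambda>z. of_real (g z)) \<in> lorentz_space lebesgue p2 1"
        "ennreal C * lorentz_norm lebesgue p1 1 (\<lambda>z. ennreal \<bar>f z\<bar>) * lorentz_norm lebesgue p2 1 (\<lambda>z. ennreal \<bar>g z\<bar>)
         < lorentz_norm lebesgue p \<infinity> (circular_maximal \<theta> (\<lambda>z. of_real (f z)) (\<lambda>z. of_real (g z)))"
        by (rule lorentz_endpoint_counterexample[OF p12(1) \<open>p1 \<le> 2\<close> pos(2) p]) blast
      then show False using leD[OF C[OF fg(1,2)]] by simp
    next
      assume "p2 \<le> 2"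
      \<comment> \<open>The counterexample exists for every angle, so it is taken at 2 pi - \<theta>
        with the exponents exchanged; the swap identity brings it back to \<theta>.\<close>
      obtain f g :: "real^2 \<Rightarrow> real" where fg: "continuous_on UNIV f" "continuous_on UNIV g"
        "(\<lambda>z. of_real (f z)) \<in> lorentz_space lebesgue p2 1"
        "(\<lambda>z. of_real (g z)) \<in> lorentz_space lebesgue p1 1"
        "ennreal C * lorentz_norm lebesgue p2 1 (\<lambda>z. ennreal \<bar>f z\<bar>) * lorentz_norm lebesgue p1 1 (\<lambda>z. ennreal \<bar>g z\<bar>)
         < lorentz_norm lebesgue p \<infinity> (circular_maximal (2 * pi - \<theta>) (\<lambda>z. of_real (f z)) (\<lambda>z. of_real (g z)))"
        by (rule lorentz_endpoint_counterexample[OF p12(2) \<open>p2 \<le> 2\<close> pos(1) p]) blast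
      moreover have "circular_maximal \<theta> (\<lambda>z. of_real (g z)) (\<lambda>z. of_real (f z))
          = circular_maximal (2 * pi - \<theta>) (\<lambda>z. of_real (f z)) (\<lambda>z. of_real (g z))"
        using fg(1,2) assms by (intro circular_maximal_swap) auto
      ultimately show False using leD[OF C[OF fg(4,3)]] by (simp add: mult_ac)
    qed
  qed
  \<comment> \<open>If \<open>p\<close> were infinite, both reciprocals would vanish and neither
    exponent could be at most 2.\<close>
  have "p < \<infinity>" if "1 < p1" "1 < p2" "1 / p1 + 1 / p2 = 1 / p" "p1 \<le> 2 \<or> p2 \<le> 2" for p1 p2 p :: ennreal
  proof (rule ccontr)
    assume "\<not> p < \<infinity>"
    then have "p = \<infinity>" by (cases p) auto
    then have "1 / p1 + 1 / p2 = 0" using that(3) by simp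
    then have "p1 = \<infinity>" "p2 = \<infinity>" by (simp_all add: ennreal_divide_eq_0_iff)
    then show False using that(4) by (auto simp: top_unique)
  qed
  with main have "\<forall>p1 p2 p :: ennreal.
            1 < p1 \<and> 1 < p2 \<and> 1 / p1 + 1 / p2 = 1 / p \<and> (p1 \<le> 2 \<or> p2 \<le> 2) \<longrightarrow>
              \<not> lorentz_bounded (circular_maximal \<theta>) (p1, 1) (p2, 1) (p, \<infinity>)"
    by blast
  moreover have "\<not> lorentz_bounded (circular_maximal \<theta>) (2, 1) (2, 1) (1, \<infinity>)"
    by (rule main) simp_all
  ultimately show ?thesis ..
qed

end
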